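(* If $p$ is a prime with $p\not\equiv\pm1\pmod 5$, then $\omega(\mathrm{Mat}_{p-1}(\mathbb{Z}))\ge (p-1)^2$.
   Context: $\mathrm{Mat}_n(\mathbb{Z})$ is the ring of $n\times n$ integer matrices. An exceptional clique in a unital ring $R$ is a subset $C\subseteq R$ such that $u-v$ is a unit of $R$ for all distinct $u,v\in C$. The clique number $\omega(R)$ is the supremum of the cardinalities of the exceptional cliques in $R$. *)

theory Defs
  imports
    "HOL-Number_Theory.Cong"
    "HOL-Library.Extended_Nat"
    "Jordan_Normal_Form.Matrix"
begin

definition exceptional_clique :: "('a, 'b) ring_scheme \<Rightarrow> 'a set \<Rightarrow> bool" where
  "exceptional_clique R C \<longleftrightarrow>
     C \<subseteq> carrier R \<and> (\<forall>u\<in>C. \<forall>v\<in>C. u \<noteq> v \<longrightarrow> u \<ominus>\<^bsub>R\<^esub> v \<in> Units R)"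

text \<open>All infinite cardinalities are identified with \<open>\<infinity>\<close>; the case distinction is needed
  because \<open>card\<close> of an infinite set is 0.\<close>

definition clique_number :: "('a, 'b) ring_scheme \<Rightarrow> enat" where
  "clique_number R =
     (SUP C \<in> {C. exceptional_clique R C}. if finite C then enat (card C) else \<infinity>)"

text \<open>The last argument of \<open>ring_mat\<close> is only the record extension slot.\<close>

abbreviation Mat_int :: "nat \<Rightarrow> int mat ring" where
  "Mat_int n \<equiv> ring_mat TYPE(int) n ()"

end

(* Let p = +-2 mod 5 be odd, S_j = sin(2 pi j c/p), psi = 2 cos(2 pi e/5). On functions of (c, e), the
   lattice L spanned by the S_j and psi S_j has rank p - 1. The quotients c_k = S_{k+1}/S_k
   (0 < k < p) preserve L and form an exceptional clique, as
   c_k - c_l = S_1 S_{l-k} / (S_k S_l) is a cyclotomic unit of norm 1. For a primitive root g let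
   T F (c, e) = (psi - 2 cos(2 pi c/p)) F (g c, e). Then T^(p-1) is multiplication by
   prod_c (psi - 2 cos(2 pi c/p)) = (2 cos(2 pi e p/5) - 2)/(psi - 2) = 2 + psi, where
   p = +-2 mod 5 is used. The (p-1)^2 operators c_k + c_l T are the clique: a difference a + b T with
   a, b nonzero is a (1 - T') with T' = -(b/a) T, and 1 - T' divides
   1 - T'^(p-1) = 1 - (2 + psi), a unit. For p = 5 the same argument runs over the split algebra
   Z[psi] x Z[psi] with the swap in place of c -> g c, and p = 2 is trivial. *)
theory Submission
  imports
    Defs
    "Jordan_Normal_Form.Determinant"
    "HOL-Number_Theory.Residue_Primitive_Roots"
    Complex_Main
begin

section \<open>Units of integer matrix rings and finite cliques\<close>

lemma int_mat_unit_of_right_inverse: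
  assumes M: "M \<in> carrier_mat n n" and N: "N \<in> carrier_mat n n"
    and MN: "M * N = 1\<^sub>m n"
  shows "M \<in> Units (Mat_int n)"
proof -
  have "det M * det N = 1"
    using MN det_mult[OF M N] by simp
  \<comment> \<open>The two determinants are inverse integers, so the adjugate scaled by
    \<open>det N\<close> is an integral left inverse of \<open>M\<close>; a left inverse must agree
    with the right inverse \<open>N\<close>.\<close>
  define P where "P = det N \<cdot>\<^sub>m adj_mat M"
  have P: "P \<in> carrier_mat n n"
    using adj_mat(1)[OF M] by (simp add: P_def)
  have "P * M = det N \<cdot>\<^sub>m (adj_mat M * M)"
    unfolding P_def using mult_smult_assoc_mat[OF adj_mat(1)[OF M] M] by simp
  also have "\<dots> = 1\<^sub>m n"
    unfolding adj_mat(3)[OF M] using \<open>det M * det N = 1\<close> by (intro eq_matI) (auto simp: mult.commute)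
  finally have PM: "P * M = 1\<^sub>m n" .
  have "P = P * (M * N)"
    using P MN by simp
  also have "\<dots> = N"
    using PM P M N by (simp flip: assoc_mult_mat)
  finally show ?thesis
    using PM MN M N by (auto simp: Units_def ring_mat_def)
qed

lemma ring_mat_minus:
  assumes "A \<in> carrier_mat n n" "B \<in> carrier_mat n n"
  shows "A \<ominus>\<^bsub>Mat_int n\<^esub> B = A - B"
proof -
  interpret ring "Mat_int n" by (rule ring_mat)
  have "\<ominus>\<^bsub>Mat_int n\<^esub> B = - B"
    using assms by (intro minus_equality) (auto simp: ring_mat_def)
  then show ?thesis
    using assms by (simp add: a_minus_def ring_mat_simps) (intro eq_matI, auto)
qed

lemma clique_number_ge_card:
  assumes "exceptional_clique R C" "finite C"
  shows "enat (card C) \<le> clique_number R"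
  unfolding clique_number_def using assms by (intro SUP_upper2[of C]) auto

section \<open>Lattices of real functions with a finite integral basis, and twisted multiplication
  operators\<close>

locale function_lattice =
  fixes n :: nat and b :: "nat \<Rightarrow> 'x \<Rightarrow> real"
  assumes independent: "(\<And>x. (\<Sum>i<n. of_int (z i) * b i x) = 0) \<Longrightarrow> i < n \<Longrightarrow> z i = (0::int)"
begin

definition comb :: "(nat \<Rightarrow> int) \<Rightarrow> 'x \<Rightarrow> real" where
  "comb z x = (\<Sum>i<n. of_int (z i) * b i x)"

definition L :: "('x \<Rightarrow> real) set" where
  "L = range comb"

lemma L_zero: "(\<lambda>x. 0) \<in> L"
  unfolding L_def by (rule image_eqI[of _ _ "\<lambda>i. 0"]) (auto simp: comb_def)

lemma L_add: "F \<in> L \<Longrightarrow> G \<in> L \<Longrightarrow> (\<lambda>x. F x + G x) \<in> L"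
proof -
  assume "F \<in> L" "G \<in> L"
  then obtain z w where "F = comb z" "G = comb w" by (auto simp: L_def)
  then have "(\<lambda>x. F x + G x) = comb (\<lambda>i. z i + w i)"
    by (auto simp: comb_def sum.distrib algebra_simps)
  then show ?thesis by (simp add: L_def)
qed

lemma L_scale: "F \<in> L \<Longrightarrow> (\<lambda>x. of_int a * F x) \<in> L"
proof -
  assume "F \<in> L"
  then obtain z where "F = comb z" by (auto simp: L_def)
  then have "(\<lambda>x. of_int a * F x) = comb (\<lambda>i. a * z i)"
    by (auto simp: comb_def sum_distrib_left algebra_simps)
  then show ?thesis by (simp add: L_def)
qed

lemma L_minus: "F \<in> L \<Longrightarrow> (\<lambda>x. - F x) \<in> L"
  using L_scale[of F "-1"] by simp

lemma L_diff: "F \<in> L \<Longrightarrow> G \<in> L \<Longrightarrow> (\<lambda>x. F x - G x) \<in> L"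
  using L_add[OF _ L_minus, of F G] by simp

lemma L_sum: "(\<And>i. i \<in> I \<Longrightarrow> F i \<in> L) \<Longrightarrow> (\<lambda>x. \<Sum>i\<in>I. F i x) \<in> L"
  by (induction I rule: infinite_finite_induct) (auto intro: L_zero L_add)

lemma basis_in_L: "i < n \<Longrightarrow> b i \<in> L"
  unfolding L_def by (rule image_eqI[of _ _ "\<lambda>j. if j = i then 1 else 0"])
    (auto simp: comb_def fun_eq_iff if_distrib[of "\<lambda>a. of_int a * _"] cong: if_cong)

text \<open>The operator is additive in \<open>F\<close>, so testing it on the basis suffices. It
  serves both for multiplication, with \<open>s\<close> the identity, and for the twist.\<close>

lemma weighted_composition_in_L:
  assumes "\<And>i. i < n \<Longrightarrow> (\<lambda>x. u x * b i (s x)) \<in> L" and "F \<in> L"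
  shows "(\<lambda>x. u x * F (s x)) \<in> L"
proof -
  obtain z where F: "F = comb z" using \<open>F \<in> L\<close> by (auto simp: L_def)
  have "(\<lambda>x. \<Sum>i<n. of_int (z i) * (u x * b i (s x))) \<in> L"
    by (intro L_sum L_scale assms) auto
  then show ?thesis
    by (simp add: F comb_def sum_distrib_left algebra_simps)
qed

definition multiplier :: "('x \<Rightarrow> real) \<Rightarrow> bool" where
  "multiplier u \<longleftrightarrow> (\<forall>F\<in>L. (\<lambda>x. u x * F x) \<in> L)"

lemma multiplierI: "(\<And>i. i < n \<Longrightarrow> (\<lambda>x. u x * b i x) \<in> L) \<Longrightarrow> multiplier u"
  unfolding multiplier_def using weighted_composition_in_L[of u "\<lambda>x. x"] by blast

lemma multiplierD: "multiplier u \<Longrightarrow> F \<in> L \<Longrightarrow> (\<lambda>x. u x * F x) \<in> L"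
  by (simp add: multiplier_def)

lemma multiplier_diff: "multiplier u \<Longrightarrow> multiplier v \<Longrightarrow> multiplier (\<lambda>x. u x - v x)"
  unfolding multiplier_def using L_diff by (simp add: left_diff_distrib)

lemma multiplier_add: "multiplier u \<Longrightarrow> multiplier v \<Longrightarrow> multiplier (\<lambda>x. u x + v x)"
  unfolding multiplier_def using L_add by (simp add: distrib_right)

lemma multiplier_const: "multiplier (\<lambda>x. of_int a)"
  unfolding multiplier_def using L_scale by simp

lemma multiplier_mult: "multiplier u \<Longrightarrow> multiplier v \<Longrightarrow> multiplier (\<lambda>x. u x * v x)"
  unfolding multiplier_def by (simp add: mult.assoc)

text \<open>\<open>M\<close> is the matrix of an additive endomorphism of \<open>L\<close> in the
  basis \<open>b\<close>. If the endomorphism is onto, the coordinates of preimages of the basis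
  functions form a right inverse of \<open>M\<close>.\<close>

lemma matrix_unit:
  assumes M: "M \<in> carrier_mat n n"
    and eq: "\<And>j x. j < n \<Longrightarrow> u x * b j x + w x * b j (s x) = (\<Sum>i<n. of_int (M $$ (i,j)) * b i x)"
    and surj: "\<And>F. F \<in> L \<Longrightarrow> \<exists>G\<in>L. \<forall>x. u x * G x + w x * G (s x) = F x"
  shows "M \<in> Units (Mat_int n)"
proof -
  have "\<exists>z. \<forall>x. u x * comb z x + w x * comb z (s x) = b j x" if "j < n" for j
    using surj[OF basis_in_L[OF that]] by (auto simp: L_def)
  then obtain z where z: "\<And>j x. j < n \<Longrightarrow> u x * comb (z j) x + w x * comb (z j) (s x) = b j x"
    by metis
  define N where "N = mat n n (\<lambda>(k,j). z j k)"
  have "(M * N) $$ (i,j) = (1\<^sub>m n) $$ (i,j)" if ij: "i < n" "j < n" for i j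
  proof -
    \<comment> \<open>Column j of \<open>M * N\<close> minus that of the identity: both columns
      represent \<open>b j\<close>, so independence forces \<open>d\<close> to vanish.\<close>
    define d where "d i = (\<Sum>k<n. M $$ (i,k) * z j k) - (if i = j then 1 else 0)" for i
    have "(\<Sum>i<n. of_int (d i) * b i x) = 0" for x
    proof -
      have "b j x = (\<Sum>k<n. of_int (z j k) * (u x * b k x + w x * b k (s x)))"
        using z[OF ij(2), of x] by (simp add: comb_def sum_distrib_left sum.distrib algebra_simps)
      also have "\<dots> = (\<Sum>k<n. \<Sum>i<n. of_int (M $$ (i,k) * z j k) * b i x)"
        by (rule sum.cong) (auto simp: eq sum_distrib_left algebra_simps)
      also have "\<dots> = (\<Sum>i<n. of_int (\<Sum>k<n. M $$ (i,k) * z j k) * b i x)"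
        by (subst sum.swap) (simp add: sum_distrib_right)
      finally show ?thesis
        using ij by (simp add: d_def left_diff_distrib sum_subtractf
            if_distrib[of "\<lambda>a. of_int a * _"] cong: if_cong)
    qed
    then have "d i = 0" using independent[of d] ij by blast
    then show ?thesis
      using ij M by (simp add: d_def N_def scalar_prod_def atLeast0LessThan)
  qed
  then have "M * N = 1\<^sub>m n"
    using M by (intro eq_matI) (auto simp: N_def)
  then show ?thesis
    using M by (intro int_mat_unit_of_right_inverse[of M n N]) (auto simp: N_def)
qed

definition twist :: "('x \<Rightarrow> real) \<Rightarrow> ('x \<Rightarrow> 'x) \<Rightarrow> ('x \<Rightarrow> real) \<Rightarrow> 'x \<Rightarrow> real" where
  "twist w s F x = w x * F (s x)"

text \<open>Where \<open>s ^^ N\<close> acts trivially, this makes the N-th power of the twist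
  multiplication by the norm of \<open>w\<close>, that is, its product along the orbit.\<close>

lemma twist_power:
  "(twist w s ^^ k) F x = (\<Prod>i<k. w ((s ^^ i) x)) * F ((s ^^ k) x)"
proof (induction k arbitrary: x)
  case (Suc k)
  have "(\<Prod>i<Suc k. w ((s ^^ i) x)) = w x * (\<Prod>i<k. w ((s ^^ i) (s x)))"
    by (subst prod.lessThan_Suc_shift) (simp add: funpow_swap1)
  moreover have "(twist w s ^^ Suc k) F x = w x * (twist w s ^^ k) F (s x)"
    by (simp add: twist_def)
  ultimately show ?case
    by (simp add: Suc funpow_swap1 del: prod.lessThan_Suc)
qed simp

text \<open>The construction in abstract form, shared by the sine lattice and the split algebra. As
  all differences of the \<open>c k\<close> have norm 1, rescaling the twist by a quotient of two
  differences does not change its N-th power. Hence a single inverse of \<open>1 - \<kappa>\<close>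
  serves all pairs; the inverse of \<open>\<kappa>\<close> handles differences that are a multiple
  of the twist alone.\<close>

theorem clique_of_twisted_multipliers:
  fixes s :: "'x \<Rightarrow> 'x" and \<theta> \<kappa> :: "'x \<Rightarrow> real" and c :: "nat \<Rightarrow> 'x \<Rightarrow> real"
  assumes n: "n > 0" and N: "even N" "N > 0"
    and period: "\<And>i x. i < n \<Longrightarrow> b i ((s ^^ N) x) = b i x"
    and shift: "\<And>i. i < n \<Longrightarrow> (\<lambda>x. \<theta> x * b i (s x)) \<in> L"
    and norm_theta: "\<And>x. (\<Prod>i<N. \<theta> ((s ^^ i) x)) = \<kappa> x"
    and kappa: "\<And>x. \<kappa> x \<noteq> 0" "multiplier (\<lambda>x. 1 / \<kappa> x)"
    and one_minus_kappa: "\<And>x. \<kappa> x \<noteq> 1" "multiplier (\<lambda>x. 1 / (1 - \<kappa> x))"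
    and c: "\<And>k. k < r \<Longrightarrow> multiplier (c k)"
    and c_diff: "\<And>k l x. k < r \<Longrightarrow> l < r \<Longrightarrow> k \<noteq> l \<Longrightarrow> c k x - c l x \<noteq> 0"
      "\<And>k l. k < r \<Longrightarrow> l < r \<Longrightarrow> k \<noteq> l \<Longrightarrow> multiplier (\<lambda>x. 1 / (c k x - c l x))"
    and norm_c_diff: "\<And>k l x. k < r \<Longrightarrow> l < r \<Longrightarrow> k \<noteq> l \<Longrightarrow>
      (\<Prod>i<N. c k ((s ^^ i) x) - c l ((s ^^ i) x)) = 1"
  shows "enat (r\<^sup>2) \<le> clique_number (Mat_int n)"
proof -
  have periodL: "F ((s ^^ N) x) = F x" if "F \<in> L" for F x
    using that by (auto simp: L_def comb_def period)
  have twistL: "twist \<theta> s F \<in> L" if "F \<in> L" for F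
    using weighted_composition_in_L[OF shift that] by (simp add: twist_def[abs_def])
  have opL: "(\<lambda>x. c k x * F x + c l x * \<theta> x * F (s x)) \<in> L" if "k < r" "l < r" "F \<in> L" for k l F
    using L_add[OF multiplierD[OF c[OF that(1)] that(3)] multiplierD[OF c[OF that(2)] twistL[OF that(3)]]]
    by (simp add: twist_def mult.assoc)
  have "\<exists>z. \<forall>x. c k x * b j x + c l x * \<theta> x * b j (s x) = comb z x"
    if "k < r" "l < r" "j < n" for k l j
    using opL[OF that(1,2) basis_in_L[OF that(3)]] by (auto simp: L_def fun_eq_iff)
  then obtain Z where Z: "\<And>k l j x. k < r \<Longrightarrow> l < r \<Longrightarrow> j < n \<Longrightarrow>
      c k x * b j x + c l x * \<theta> x * b j (s x) = comb (Z k l j) x"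
    by metis
  define X where "X = (\<lambda>(k,l). mat n n (\<lambda>(i,j). Z k l j i))"
  have Xcarrier: "X q \<in> carrier_mat n n" for q
    by (auto simp: X_def split: prod.split)
  have X: "c k x * b j x + c l x * \<theta> x * b j (s x) = (\<Sum>i<n. of_int (X (k,l) $$ (i,j)) * b i x)"
    if "k < r" "l < r" "j < n" for k l j x
    using Z[OF that] that by (simp add: X_def comb_def)
  have unit: "X q - X q' \<in> Units (Mat_int n)"
    if q: "q \<in> {..<r} \<times> {..<r}" "q' \<in> {..<r} \<times> {..<r}" "q \<noteq> q'" for q q'
  proof -
    obtain k l k' l' where [simp]: "q = (k,l)" "q' = (k',l')" by (metis surj_pair)
    have lt: "k < r" "l < r" "k' < r" "l' < r" using q by auto
    define u v where "u = (\<lambda>x. c k x - c k' x)" and "v = (\<lambda>x. c l x - c l' x)"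
    have u: "\<And>x. u x \<noteq> 0" "multiplier (\<lambda>x. 1 / u x)" "\<And>x. (\<Prod>i<N. u ((s ^^ i) x)) = 1"
      if "k \<noteq> k'" using that lt c_diff norm_c_diff by (auto simp: u_def)
    have v: "\<And>x. v x \<noteq> 0" "multiplier (\<lambda>x. 1 / v x)" "\<And>x. (\<Prod>i<N. v ((s ^^ i) x)) = 1"
      if "l \<noteq> l'" using that lt c_diff norm_c_diff by (auto simp: v_def)
    have v0: "multiplier v" using c lt unfolding v_def by (intro multiplier_diff) auto
    have surj: "\<exists>G\<in>L. \<forall>x. u x * G x + (v x * \<theta> x) * G (s x) = F x" if F: "F \<in> L" for F
    proof (cases "k = k'")
      case False
      \<comment> \<open>\<open>u + v T = u (1 - T')\<close> with \<open>T' = twist w s\<close>, inverted by the geometric series.\<close>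
      define w where "w x = - (v x * (1 / u x)) * \<theta> x" for x
      have wL: "twist w s H \<in> L" if "H \<in> L" for H
        using L_minus[OF multiplierD[OF v0 multiplierD[OF u(2)[OF False] twistL[OF that]]]]
        by (simp add: twist_def[abs_def] w_def mult.assoc)
      \<comment> \<open>For equal second indices \<open>w\<close> is zero. Otherwise the signs
        cancel because \<open>N\<close> is even, and the norms of \<open>u\<close> and
        \<open>v\<close> are 1.\<close>
      have norm_w: "(\<Prod>i<N. w ((s ^^ i) x)) = (if l = l' then 0 else \<kappa> x)" for x
      proof (cases "l = l'")
        case True
        then have "w y = 0" for y by (simp add: w_def v_def)
        then show ?thesis using N True by (auto simp: prod_zero_iff)
      next
        case l: False
        have "(\<Prod>i<N. w ((s ^^ i) x)) = (\<Prod>i<N. - (v ((s ^^ i) x) * (1 / u ((s ^^ i) x)) * \<theta> ((s ^^ i) x)))"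
          by (simp add: w_def)
        also have "\<dots> = (\<Prod>i<N. v ((s ^^ i) x)) / (\<Prod>i<N. u ((s ^^ i) x)) * (\<Prod>i<N. \<theta> ((s ^^ i) x))"
          using N by (subst prod_uminus) (simp add: prod.distrib prod_dividef)
        finally show ?thesis using u(3)[OF False] v(3)[OF l] norm_theta l by simp
      qed
      define \<mu> where "\<mu> x = 1 - (\<Prod>i<N. w ((s ^^ i) x))" for x
      have \<mu>: "\<mu> x \<noteq> 0" "multiplier (\<lambda>x. 1 / \<mu> x)" for x
        using one_minus_kappa multiplier_const[of 1] by (cases "l = l'"; simp add: \<mu>_def norm_w)+
      \<comment> \<open>The sum \<open>G\<close> of the first \<open>N\<close> iterates satisfies (1
        - T') G = (1 - T'^N) H = \<open>\<mu>\<close> H, so dividing F by \<open>\<mu>\<close> and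
        \<open>u\<close> beforehand gives exactly F / u.\<close>
      define H where "H x = 1 / \<mu> x * (1 / u x * F x)" for x
      have H: "H \<in> L"
        using multiplierD[OF \<mu>(2) multiplierD[OF u(2)[OF False] F]] by (simp add: H_def[abs_def])
      have HL: "(twist w s ^^ i) H \<in> L" for i
        by (induction i) (auto intro: H wL)
      define G where "G x = (\<Sum>i<N. (twist w s ^^ i) H x)" for x
      have G: "G \<in> L" unfolding G_def[abs_def] by (intro L_sum HL)
      have "u x * G x + (v x * \<theta> x) * G (s x) = F x" for x
      proof -
        have "twist w s G x = (\<Sum>i<N. (twist w s ^^ Suc i) H x)"
          by (simp add: G_def twist_def sum_distrib_left)
        then have "G x - twist w s G x = H x - (twist w s ^^ N) H x"
          using sum_lessThan_telescope'[of "\<lambda>i. (twist w s ^^ i) H x" N]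
          by (simp add: G_def sum_subtractf del: funpow.simps)
        also have "\<dots> = \<mu> x * H x"
          by (simp add: twist_power periodL[OF H] \<mu>_def algebra_simps)
        finally have "u x * (G x - twist w s G x) = F x"
          using u(1)[OF False] \<mu>(1) by (simp add: H_def)
        moreover have "u x * twist w s G x = - (v x * \<theta> x) * G (s x)"
          using u(1)[OF False, of x] by (simp add: twist_def w_def)
        ultimately show ?thesis
          by (simp add: right_diff_distrib)
      qed
      then show ?thesis using G by blast
    next
      case True
      then have l: "l \<noteq> l'" using q by auto
      have H: "(\<lambda>x. 1 / v x * F x) \<in> L" using multiplierD[OF v(2)[OF l] F] .
      \<comment> \<open>Now the operator is v T with T^N = \<open>\<kappa>\<close>, so T^(N-1)
        applied to this \<open>H\<close> is a preimage of \<open>F\<close>.\<close>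
      define H where "H x = 1 / \<kappa> x * (1 / v x * F x)" for x
      have H: "H \<in> L"
        using multiplierD[OF kappa(2) H] by (simp add: H_def[abs_def])
      have HL: "(twist \<theta> s ^^ i) H \<in> L" for i
        by (induction i) (auto intro: H twistL)
      have "(v x * \<theta> x) * (twist \<theta> s ^^ (N - 1)) H (s x) = F x" for x
      proof -
        have "\<theta> x * (twist \<theta> s ^^ (N - 1)) H (s x) = (twist \<theta> s ^^ Suc (N - 1)) H x"
          by (simp add: twist_def)
        also have "\<dots> = \<kappa> x * H x"
          using N by (simp add: twist_power periodL[OF H] norm_theta del: funpow.simps)
        finally show ?thesis using kappa(1) v(1)[OF l] by (simp add: H_def mult.assoc)
      qed
      then show ?thesis using HL True by (auto simp: u_def)
    qed
    show ?thesis
    proof (rule matrix_unit[where u = u and w = "\<lambda>x. v x * \<theta> x" and s = s])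
      show "X q - X q' \<in> carrier_mat n n" using Xcarrier by (metis minus_carrier_mat)
      fix j x assume j: "j < n"
      have "(\<Sum>i<n. of_int ((X q - X q') $$ (i,j)) * b i x) =
          (\<Sum>i<n. of_int (X q $$ (i,j)) * b i x) - (\<Sum>i<n. of_int (X q' $$ (i,j)) * b i x)"
        using j Xcarrier[of q] Xcarrier[of q'] by (simp add: left_diff_distrib flip: sum_subtractf)
      then show "u x * b j x + v x * \<theta> x * b j (s x) =
          (\<Sum>i<n. of_int ((X q - X q') $$ (i,j)) * b i x)"
        using X[OF lt(1,2) j, of x] X[OF lt(3,4) j, of x] by (simp add: u_def v_def algebra_simps)
    qed (rule surj)
  qed
  \<comment> \<open>That the r^2 matrices are distinct comes from the same computation: differences
    for distinct index pairs are units, and zero is not a unit since \<open>n > 0\<close>.\<close>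
  have zero: "0\<^sub>m n n \<notin> Units (Mat_int n)"
  proof
    assume "0\<^sub>m n n \<in> Units (Mat_int n)"
    then have "0\<^sub>m n n = (1\<^sub>m n :: int mat)"
      by (auto simp: Units_def ring_mat_def)
    then have "(0\<^sub>m n n :: int mat) $$ (0,0) = 1\<^sub>m n $$ (0,0)" by simp
    then show False using n by simp
  qed
  have inj: "inj_on X ({..<r} \<times> {..<r})"
  proof (rule inj_onI, rule ccontr)
    fix q q' assume "q \<in> {..<r} \<times> {..<r}" "q' \<in> {..<r} \<times> {..<r}" "X q = X q'" "q \<noteq> q'"
    then have "X q - X q \<in> Units (Mat_int n)" using unit by metis
    then show False using zero Xcarrier[of q] by simp
  qed
  have "exceptional_clique (Mat_int n) (X ` ({..<r} \<times> {..<r}))"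
    unfolding exceptional_clique_def
  proof (intro conjI ballI impI)
    show "X ` ({..<r} \<times> {..<r}) \<subseteq> carrier (Mat_int n)"
      using Xcarrier by (auto simp: ring_mat_simps)
    fix A B assume "A \<in> X ` ({..<r} \<times> {..<r})" "B \<in> X ` ({..<r} \<times> {..<r})" "A \<noteq> B"
    then obtain q q' where "A = X q" "B = X q'" "q \<in> {..<r} \<times> {..<r}" "q' \<in> {..<r} \<times> {..<r}" "q \<noteq> q'"
      by blast
    then show "A \<ominus>\<^bsub>Mat_int n\<^esub> B \<in> Units (Mat_int n)"
      using unit ring_mat_minus[OF Xcarrier Xcarrier] by simp
  qed
  from clique_number_ge_card[OF this] show ?thesis
    by (simp add: card_image[OF inj] power2_eq_square)
qed

end

section \<open>Quadratic units: \<open>psi\<close> runs over the two real roots of X^2 + X -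
  1\<close>

definition psi :: "bool \<Rightarrow> real" where
  "psi e = (if e then (sqrt 5 - 1) / 2 else (- sqrt 5 - 1) / 2)"

lemma psi_square: "psi e * psi e = 1 - psi e"
  by (auto simp: psi_def field_simps)

lemma psi_Not: "psi (\<not> e) = -1 - psi e"
  by (simp add: psi_def field_simps)

lemma psi_cancel: "psi e * (psi e * z) = z - psi e * z"
  using psi_square[of e] by (simp flip: mult.assoc add: left_diff_distrib)

lemma psi_unit: "psi e \<noteq> 0" "1 + psi e \<noteq> 0" "2 + psi e \<noteq> 0"
proof -
  show "psi e \<noteq> 0" using psi_square[of e] by auto
  show "1 + psi e \<noteq> 0" using psi_square[of e] by (auto simp: add_eq_0_iff)
  show "2 + psi e \<noteq> 0"
  proof
    assume "2 + psi e = 0"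
    then have "psi e = -2" by simp
    then show False using psi_square[of e] by simp
  qed
qed

text \<open>From psi (1 + psi) = 1 and (1 + psi)^2 = 2 + psi. Once inverses are polynomials in
  \<open>psi\<close>, the closure rules for multipliers apply to them.\<close>

lemma kappa_inverse: "1 / (2 + psi e) = psi e * psi e"
  using psi_square[of e] psi_unit[of e] by (simp add: field_simps) (simp add: psi_cancel psi_square algebra_simps)

lemma one_minus_kappa_inverse: "1 / (1 - (2 + psi e)) = - psi e"
  using psi_square[of e] psi_unit[of e] by (simp add: field_simps)

text \<open>A single real value of \<open>psi\<close> could never separate real coefficients; the
  relation is imposed at both conjugates, and subtracting the two isolates \<open>y\<close>.\<close>

lemma psi_independent:
  fixes x y :: real
  assumes "\<And>e. x + y * psi e = 0"
  shows "x = 0 \<and> y = 0"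
proof -
  have "y * (psi True - psi False) = 0"
    using assms[of True] assms[of False] by (simp only: right_diff_distrib)
  moreover have "psi True \<noteq> psi False"
    by (simp add: psi_def field_simps)
  ultimately have "y = 0" by simp
  then show ?thesis using assms[of True] by simp
qed

section \<open>The case p = 5: the split algebra Z[psi] x Z[psi]\<close>

definition split_basis :: "nat \<Rightarrow> bool \<times> bool \<Rightarrow> real" where
  "split_basis i = (\<lambda>(s, e). if s = (i < 2) then psi e ^ (i mod 2) else 0)"

interpretation split: function_lattice 4 split_basis
proof
  fix z :: "nat \<Rightarrow> int" and i :: nat
  assume *: "\<And>x. (\<Sum>i<4. of_int (z i) * split_basis i x) = 0" and "i < 4"
  have "of_int (z 0) + of_int (z 1) * psi e = 0" "of_int (z 2) + of_int (z 3) * psi e = 0" for e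
    using *[of "(True, e)"] *[of "(False, e)"]
    by (simp_all add: split_basis_def lessThan_nat_numeral lessThan_Suc)
  then have "z 0 = 0" "z 1 = 0" "z 2 = 0" "z 3 = 0"
    using psi_independent[of "of_int (z 0)" "of_int (z 1)"] psi_independent[of "of_int (z 2)" "of_int (z 3)"]
    by auto
  moreover have "i = 0 \<or> i = 1 \<or> i = 2 \<or> i = 3" using \<open>i < 4\<close> by auto
  ultimately show "z i = 0" by auto
qed

text \<open>The first boolean names the factor, the second the real embedding. This root of X^2 + X
  - 1 is \<open>psi\<close> in one factor and its conjugate in the other, so exchanging the factors
  conjugates it, whereas the diagonal \<open>psi\<close> stays fixed.\<close>

definition split_root :: "bool \<times> bool \<Rightarrow> real" where
  "split_root = (\<lambda>(s, e). if s then psi e else -1 - psi e)"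

lemma split_cases: "i < 4 \<Longrightarrow> i = 0 \<or> i = 1 \<or> i = 2 \<or> i = (3::nat)"
  by auto

lemma split_member: "i < 4 \<Longrightarrow> split_basis i \<in> split.L"
  by (rule split.basis_in_L)

lemma multiplier_psi_split: "split.multiplier (\<lambda>x. psi (snd x))"
proof (rule split.multiplierI)
  fix i :: nat assume "i < 4"
  have "(\<lambda>x. psi (snd x) * split_basis 0 x) = split_basis 1"
    "(\<lambda>x. psi (snd x) * split_basis 1 x) = (\<lambda>x. split_basis 0 x - split_basis 1 x)"
    "(\<lambda>x. psi (snd x) * split_basis 2 x) = split_basis 3"
    "(\<lambda>x. psi (snd x) * split_basis 3 x) = (\<lambda>x. split_basis 2 x - split_basis 3 x)"
    by (auto simp: split_basis_def psi_square)
  then show "(\<lambda>x. psi (snd x) * split_basis i x) \<in> split.L"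
    using split_cases[OF \<open>i < 4\<close>] by (auto intro!: split.L_diff split_member)
qed

lemma multiplier_root_split: "split.multiplier split_root"
proof (rule split.multiplierI)
  fix i :: nat assume "i < 4"
  have "(\<lambda>x. split_root x * split_basis i x) =
      (if i < 2 then (\<lambda>x. psi (snd x) * split_basis i x)
       else (\<lambda>x. - split_basis i x - psi (snd x) * split_basis i x))"
    by (auto simp: split_basis_def split_root_def algebra_simps)
  moreover have "\<dots> \<in> split.L"
    using split.multiplierD[OF multiplier_psi_split split_member[OF \<open>i < 4\<close>]] split_member[OF \<open>i < 4\<close>]
    by (auto intro!: split.L_diff split.L_minus)
  ultimately show "(\<lambda>x. split_root x * split_basis i x) \<in> split.L" by simp
qed

lemma split_root_square: "split_root x * split_root x = 1 - split_root x"
  using psi_square[of "snd x"] by (cases x) (auto simp: split_root_def algebra_simps)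

lemma split_root_flip: "split_root (\<not> s, e) = -1 - split_root (s, e)"
  by (simp add: split_root_def)

definition split_swap :: "bool \<times> bool \<Rightarrow> bool \<times> bool" where
  "split_swap = (\<lambda>(s, e). (\<not> s, e))"

text \<open>These are the three properties that \<open>clique_of_twisted_multipliers\<close> asks of
  a difference of two of the \<open>c k\<close>, with \<open>N = 4\<close>.\<close>

definition split_unit :: "(bool \<times> bool \<Rightarrow> real) \<Rightarrow> bool" where
  "split_unit u \<longleftrightarrow> (\<forall>x. u x \<noteq> 0) \<and> split.multiplier (\<lambda>x. 1 / u x) \<and>
     (\<forall>x. (\<Prod>i<4. u ((split_swap ^^ i) x)) = 1)"

text \<open>The swap has order 2, so a product over four steps is the square of one over two steps.
  This is how norm -1 becomes norm 1.\<close>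

lemma split_unitI:
  assumes "\<And>x. u x * v x = 1" "split.multiplier v" "\<And>x. u x * u (split_swap x) = -1 \<or> u x * u (split_swap x) = 1"
  shows "split_unit u"
proof -
  have "u x \<noteq> 0" for x using assms(1)[of x] by auto
  moreover have "1 / u x = v x" for x using assms(1)[of x] \<open>u x \<noteq> 0\<close> by (simp add: field_simps)
  moreover have "(\<Prod>i<4. u ((split_swap ^^ i) x)) = (u x * u (split_swap x)) * (u x * u (split_swap x))" for x
    by (cases x) (simp add: eval_nat_numeral split_swap_def)
  moreover have "(u x * u (split_swap x)) * (u x * u (split_swap x)) = 1" for x
    using assms(3)[of x] by (elim disjE) simp_all
  ultimately show ?thesis
    using assms(2) by (simp only: split_unit_def) simp
qed

lemma split_unitD:
  assumes "split_unit u"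
  shows "u x \<noteq> 0" "split.multiplier (\<lambda>x. 1 / u x)" "(\<Prod>i<4. u ((split_swap ^^ i) x)) = 1"
  using assms by (auto simp: split_unit_def simp del: split_paired_All)

lemma split_unit_uminus: "split_unit u \<Longrightarrow> split_unit (\<lambda>x. - u x)"
  using split.multiplier_mult[OF split.multiplier_const[of "-1"], of "\<lambda>x. 1 / u x"]
  by (simp add: split_unit_def prod_uminus)

lemma split_units:
  "split_unit (\<lambda>x. 1)" "split_unit split_root" "split_unit (\<lambda>x. 1 + split_root x)"
  "split_unit (\<lambda>x. split_root x - 1)"
proof -
  note [simp] = split.multiplier_const[of 1, simplified]
  have 1: "split.multiplier (\<lambda>x. 1 + split_root x)"
    by (intro split.multiplier_add multiplier_root_split) simp
  show "split_unit (\<lambda>x. 1)" by (rule split_unitI[of _ "\<lambda>x. 1"]) auto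
  show "split_unit split_root"
    by (rule split_unitI[of _ "\<lambda>x. 1 + split_root x"])
      (auto simp: 1 split_swap_def split_root_flip algebra_simps split_root_square)
  show "split_unit (\<lambda>x. 1 + split_root x)"
    by (rule split_unitI[of _ split_root])
      (auto simp: multiplier_root_split split_swap_def split_root_flip algebra_simps split_root_square)
  \<comment> \<open>The swap sends 1 - root to 2 + root, which is also its inverse.\<close>
  have "split_unit (\<lambda>x. 1 - split_root x)"
    by (rule split_unitI[of _ "\<lambda>x. 2 + split_root x"])
      (use split.multiplier_add[OF split.multiplier_const[of 2] multiplier_root_split] in
        \<open>auto simp: split_swap_def split_root_flip left_diff_distrib right_diff_distrib distrib_left
          distrib_right split_root_square\<close>)
  from split_unit_uminus[OF this] show "split_unit (\<lambda>x. split_root x - 1)" by simp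
qed

text \<open>Up to sign, the differences of 0, 1, root, 1 + root are 1, root, 1 + root and root - 1,
  all units. The twist exchanges the factors and scales one of them by -1 - psi, so its square is -1
  - psi and its fourth power 2 + psi.\<close>

lemma clique_number_Mat_4: "enat (4\<^sup>2) \<le> clique_number (Mat_int 4)"
proof (rule split.clique_of_twisted_multipliers[where s = split_swap and N = 4 
      and \<theta> = "\<lambda>(s, e). if s then - 1 - psi e else 1" and \<kappa> = "\<lambda>x. 2 + psi (snd x)"
      and c = "\<lambda>k x. [0, 1, split_root x, 1 + split_root x] ! k"])
  fix i :: nat and x assume i: "i < 4"
  show "split_basis i ((split_swap ^^ 4) x) = split_basis i x"
    by (cases x) (simp add: eval_nat_numeral split_swap_def)
  let ?i = "if i < 2 then i + 2 else i - 2"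
  have "(\<lambda>x. (case x of (s, e) \<Rightarrow> if s then - 1 - psi e else 1) * split_basis i (split_swap x)) =
    (if i < 2 then split_basis (i + 2) else (\<lambda>x. - split_basis (i - 2) x - psi (snd x) * split_basis (i - 2) x))"
    using split_cases[OF i] by (auto simp: split_basis_def split_swap_def algebra_simps)
  also have "\<dots> \<in> split.L"
    using i by (auto intro!: split.L_diff split.L_minus split_member split.multiplierD[OF multiplier_psi_split])
  finally show "(\<lambda>x. (case x of (s, e) \<Rightarrow> if s then - 1 - psi e else 1) * split_basis i (split_swap x)) \<in> split.L" .
next
  fix x :: "bool \<times> bool"
  show "(\<Prod>i<4. (case (split_swap ^^ i) x of (s, e) \<Rightarrow> if s then - 1 - psi e else 1)) = 2 + psi (snd x)"
  proof -
    have "(-1 - psi (snd x)) * (-1 - psi (snd x)) = 2 + psi (snd x)"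
      by (simp add: algebra_simps psi_square)
    then show ?thesis
      by (cases x; cases "fst x") (simp_all add: eval_nat_numeral split_swap_def)
  qed
  show "2 + psi (snd x) \<noteq> 0" "2 + psi (snd x) \<noteq> 1"
    using psi_unit[of "snd x"] by auto
next
  show "split.multiplier (\<lambda>x. 1 / (2 + psi (snd x)))"
    unfolding kappa_inverse by (intro split.multiplier_mult multiplier_psi_split)
  show "split.multiplier (\<lambda>x. 1 / (1 - (2 + psi (snd x))))"
    unfolding one_minus_kappa_inverse
    using split.multiplier_mult[OF split.multiplier_const[of "-1"] multiplier_psi_split] by simp
next
  fix k :: nat assume k: "k < 4"
  show "split.multiplier (\<lambda>x. [0, 1, split_root x, 1 + split_root x] ! k)"
    using split_cases[OF k] split.multiplier_const[of 1] split.multiplier_const[of 0] multiplier_root_split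
      split.multiplier_add[OF split.multiplier_const[of 1] multiplier_root_split] by auto
next
  let ?c = "\<lambda>k x. [0, 1, split_root x, 1 + split_root x] ! k"
  have less: "split_unit (\<lambda>x. ?c l x - ?c k x)" if "l < 4" "k < l" for k l :: nat
  proof -
    have "(k,l) \<in> {(0,1),(0,2),(0,3),(1,2),(1,3),(2,3)}" using that by auto
    then show ?thesis using split_units by (elim insertE emptyE) simp_all
  qed
  have unit: "split_unit (\<lambda>x. ?c k x - ?c l x)" if "k < 4" "l < 4" "k \<noteq> l" for k l
    using that(3) less[OF that(1)] split_unit_uminus[OF less[OF that(2)]] by (cases k l rule: linorder_cases) simp_all
  fix k l :: nat and x assume *: "k < 4" "l < 4" "k \<noteq> l"
  show "?c k x - ?c l x \<noteq> 0" "split.multiplier (\<lambda>x. 1 / (?c k x - ?c l x))"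
    "(\<Prod>i<4. ?c k ((split_swap ^^ i) x) - ?c l ((split_swap ^^ i) x)) = 1"
    by (rule split_unitD[OF unit[OF *]])+
qed simp_all

section \<open>Products and sums over roots of unity, and the cosines of the regular
  pentagon\<close>

lemma prod_diff_roots_unity:
  fixes z :: complex
  assumes "n > 0"
  shows "(\<Prod>k<n. z - cis (2 * pi * real k / real n)) = z ^ n - 1"
proof -
  define q where "q = (\<Prod>k<n. [:- cis (2 * pi * real k / real n), 1:])"
  define r where "r = Polynomial.monom 1 n - (1 :: complex poly)"
  have "Polynomial.lead_coeff q = (\<Prod>k<n. Polynomial.lead_coeff [:- cis (2 * pi * real k / real n), 1:])"
    unfolding q_def by (rule lead_coeff_prod)
  then have deg: "Polynomial.degree q = n" "Polynomial.lead_coeff q = 1"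
    by (simp_all add: q_def degree_prod_sum_eq)
  have r: "Polynomial.degree r = n" "Polynomial.coeff r n = 1"
    using assms by (auto simp: r_def Polynomial.coeff_monom degree_monom_eq intro!: antisym le_degree degree_diff_le)
  \<comment> \<open>Both polynomials are monic of degree n, so their difference has degree below n,
    yet it vanishes at all n roots of unity.\<close>
  have "q = r"
  proof (rule ccontr)
    assume "q \<noteq> r"
    then have ne: "q - r \<noteq> 0" by simp
    have "Polynomial.degree (q - r) < n"
    proof -
      have "Polynomial.degree (q - r) \<le> n" using deg r by (intro degree_diff_le) auto
      moreover have "Polynomial.coeff (q - r) n = 0" using deg r by simp
      ultimately show ?thesis
        using ne by (metis leading_coeff_0_iff order_le_less)
    qed
    moreover have "{z. z ^ n = 1} \<subseteq> {z. poly (q - r) z = 0}"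
    proof
      fix z :: complex assume "z \<in> {z. z ^ n = 1}"
      moreover from this obtain k where "k < n" "z = cis (2 * pi * real k / real n)"
        using bij_betw_imp_surj_on[OF bij_betw_roots_unity[OF assms]] by auto
      then have "poly q z = 0"
        using assms by (force simp: q_def poly_prod)
      ultimately show "z \<in> {z. poly (q - r) z = 0}"
        by (simp add: r_def poly_monom)
    qed
    then have "n \<le> card {z. poly (q - r) z = 0}"
      using card_mono[OF poly_roots_finite[OF ne]] card_roots_unity_eq[OF assms] by metis
    ultimately show False using card_poly_roots_bound[OF ne] by simp
  qed
  then have "poly q z = poly r z" by simp
  then show ?thesis by (simp add: q_def r_def poly_prod poly_monom)
qed

text \<open>With z = e^(ia) and w = e^(ib), z (2 cos a - 2 cos b) = (z - w)(z - 1/w). Over all n-th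
  roots of unity w each family of factors gives z^n - 1, and (z^n - 1)^2 = z^n (2 cos(na) -
  2).\<close>

lemma prod_diff_cos:
  assumes "n > 0"
  shows "(\<Prod>k<n. 2 * cos a - 2 * cos (2 * pi * real k / real n)) = 2 * cos (real n * a) - 2"
proof -
  let ?w = "\<lambda>k. cis (2 * pi * real k / real n)"
  define z where "z = cis a"
  have z: "z \<noteq> 0" "cnj z = 1 / z" by (auto simp: z_def field_simps cis_cnj cis_mult)
  have cos_eq: "complex_of_real (2 * cos b) = cis b + cnj (cis b)" for b
    by (simp add: complex_eq_iff)
  \<comment> \<open>The factor z - 1/w is written as a conjugate so that the factorization of X^n -
    1 applies to it at \<open>cnj z\<close>.\<close>
  have factor: "z * complex_of_real (2 * cos a - 2 * cos b) = (z - cis b) * cnj (cnj z - cis b)" for b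
  proof -
    have "cis b * cnj (cis b) = 1" by (simp add: cis_cnj cis_mult)
    moreover have "z * cnj z = 1" using z by simp
    ultimately show ?thesis unfolding of_real_diff cos_eq z_def by (simp add: algebra_simps)
  qed
  have "z ^ n * complex_of_real (\<Prod>k<n. 2 * cos a - 2 * cos (2 * pi * real k / real n))
      = (\<Prod>k<n. z * complex_of_real (2 * cos a - 2 * cos (2 * pi * real k / real n)))"
    by (simp add: prod.distrib)
  also have "\<dots> = (\<Prod>k<n. z - ?w k) * cnj (\<Prod>k<n. cnj z - ?w k)"
    unfolding factor by (simp add: prod.distrib)
  also have "\<dots> = (z ^ n - 1) * (z ^ n - 1)"
    unfolding prod_diff_roots_unity[OF assms] by simp
  also have "\<dots> = z ^ n * complex_of_real (2 * cos (real n * a) - 2)"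
  proof -
    have "z ^ n * cnj (z ^ n) = 1" using z by (simp flip: power_mult_distrib)
    moreover have "z ^ n = cis (real n * a)" by (simp add: z_def DeMoivre)
    ultimately show ?thesis unfolding of_real_diff cos_eq by (simp add: algebra_simps)
  qed
  finally show ?thesis using z by (simp only: mult_cancel_left of_real_eq_iff) simp
qed

text \<open>Multiplying by 2 sin(pi l / n), which is nonzero as n does not divide l, makes the sum
  telescope, and the two end terms cancel.\<close>

lemma sum_cos_multiples:
  fixes l :: int
  assumes "n > 0" "\<not> int n dvd l"
  shows "(\<Sum>k<n. cos (2 * pi * of_int l * real k / real n)) = 0"
proof -
  define a where "a = pi * of_int l / real n"
  have sin: "sin a \<noteq> 0"
  proof
    assume "sin a = 0"
    then obtain i :: int where "a = of_int i * pi" by (auto simp: sin_zero_iff_int2)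
    then have "(of_int l :: real) = of_int (i * int n)" using assms(1) by (simp add: a_def field_simps)
    then show False using assms(2) by (simp only: of_int_eq_iff) simp
  qed
  have "2 * sin a * (\<Sum>k<n. cos (2 * pi * of_int l * real k / real n))
      = (\<Sum>k<n. sin (a * (2 * real (Suc k) - 1)) - sin (a * (2 * real k - 1)))"
    unfolding sum_distrib_left
  proof (rule sum.cong[OF refl])
    fix k
    have "2 * pi * of_int l * real k / real n = a * (2 * real k)" by (simp add: a_def)
    then show "2 * sin a * cos (2 * pi * of_int l * real k / real n)
        = sin (a * (2 * real (Suc k) - 1)) - sin (a * (2 * real k - 1))"
      by (simp add: algebra_simps sin_add sin_diff)
  qed
  also have "\<dots> = sin (a * (2 * real n - 1)) + sin a"
    by (subst sum_lessThan_telescope) simp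
  also have "a * (2 * real n - 1) = 2 * pi * of_int l - a"
    using assms(1) by (simp add: a_def field_simps)
  also have "sin (2 * pi * of_int l - a) = - sin a"
    by (simp add: sin_diff sin_int_2pin cos_int_2pin)
  finally show ?thesis using sin by simp
qed

text \<open>Doubling the angle exchanges the two cosines, so x = 2 cos(2 pi/5) satisfies x = (x^2 -
  2)^2 - 2, which factors as (x - 2)(x + 1)(x^2 + x - 1) = 0; the bounds 0 < x < 2 leave the
  quadratic factor.\<close>

lemma cos_2pi_5: "2 * cos (2 * pi / 5) = (sqrt 5 - 1) / 2"
  and cos_4pi_5: "2 * cos (4 * pi / 5) = (- sqrt 5 - 1) / 2"
proof -
  define x where "x = 2 * cos (2 * pi / 5)"
  define y where "y = 2 * cos (4 * pi / 5)"
  have y: "y = x\<^sup>2 - 2"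
    using cos_double_cos[of "2 * pi / 5"] by (simp add: x_def y_def power2_eq_square field_simps)
  have "cos (8 * pi / 5) = cos (2 * pi / 5)"
    using cos_2pi_minus[of "2 * pi / 5"] by (simp add: field_simps)
  then have x: "x = y\<^sup>2 - 2"
    using cos_double_cos[of "4 * pi / 5"] by (simp add: x_def y_def power2_eq_square field_simps)
  have "0 < x" unfolding x_def by (simp add: cos_gt_zero)
  have "x < 2" unfolding x_def using cos_monotone_0_pi[of 0 "2 * pi / 5"] by simp
  have "(x - 2) * ((x + 1) * (x\<^sup>2 + x - 1)) = 0"
    using x unfolding y by (simp add: power2_eq_square algebra_simps)
  then have root: "x\<^sup>2 + x - 1 = 0" using \<open>0 < x\<close> \<open>x < 2\<close> by simp
  then have "(2 * x + 1)\<^sup>2 = 5" by (simp add: power2_eq_square algebra_simps)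
  then have "2 * x + 1 = sqrt 5" using \<open>0 < x\<close> by (intro real_sqrt_unique[symmetric]) auto
  then show "2 * cos (2 * pi / 5) = (sqrt 5 - 1) / 2" by (simp add: x_def)
  moreover have "y = - 1 - x" using y root by simp
  ultimately show "2 * cos (4 * pi / 5) = (- sqrt 5 - 1) / 2"
    by (simp add: x_def y_def field_simps)
qed

lemma trig_cong:
  fixes a b :: int
  assumes "[a = b] (mod int n)" "n > 0"
  shows "cos (2 * pi * of_int a / real n) = cos (2 * pi * of_int b / real n)"
    "sin (2 * pi * of_int a / real n) = sin (2 * pi * of_int b / real n)"
proof -
  obtain k where "b = a + int n * k" using assms(1) by (auto simp: cong_iff_lin)
  then have "2 * pi * of_int b / real n = 2 * pi * of_int a / real n + 2 * pi * of_int k"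
    using assms(2) by (simp add: field_simps)
  then show "cos (2 * pi * of_int a / real n) = cos (2 * pi * of_int b / real n)"
    "sin (2 * pi * of_int a / real n) = sin (2 * pi * of_int b / real n)"
    by (simp_all add: cos_add sin_add sin_int_2pin cos_int_2pin)
qed

section \<open>Sines and cosines at the residues modulo p, ordered by a primitive root\<close>

locale sine_lattice =
  fixes p g :: nat
  assumes prime_p: "prime p" and odd_p: "odd p" and primroot: "residue_primroot p g"
begin

lemma p_gt: "p > 2" 
  using prime_p odd_p prime_ge_2_nat[of p] by (cases "p = 2") auto

definition m :: nat where "m = (p - 1) div 2"

lemma m: "p = 2 * m + 1" "m > 0"
  using odd_p p_gt by (auto simp: m_def elim!: oddE)

text \<open>A point \<open>(t, e)\<close> stands for the residue \<open>g ^ t\<close>; with exponents in place of residues no \<open>S j\<close> with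
  \<open>\<not> p dvd j\<close> has a zero, so quotients never divide by 0.\<close>

definition S :: "int \<Rightarrow> nat \<times> bool \<Rightarrow> real" where
  "S j x = sin (2 * pi * of_int (j * int g ^ fst x) / real p)"

definition C :: "int \<Rightarrow> nat \<times> bool \<Rightarrow> real" where
  "C j x = 2 * cos (2 * pi * of_int (j * int g ^ fst x) / real p)"

definition next_point :: "nat \<times> bool \<Rightarrow> nat \<times> bool" where
  "next_point = (\<lambda>(t, e). (Suc t, e))"

lemma next_point_power: "(next_point ^^ i) x = (i + fst x, snd x)"
  by (induction i) (auto simp: next_point_def)

lemma coprime_g: "coprime p g" "coprime (int p) (int g)"
  using primroot by (auto simp: residue_primroot_def)

lemma g_power_bij: "bij_betw (\<lambda>i. g ^ i mod p) {..<p - 1} {1..<p}"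
proof -
  have "totatives p = {1..<p}"
    unfolding totatives_prime[OF prime_p] by auto
  moreover have "totient p = p - 1"
    by (rule totient_prime[OF prime_p])
  moreover have "1 < p" using p_gt by simp
  ultimately show ?thesis
    using residue_primroot_is_generator[OF _ primroot] by metis
qed

lemma power_of_g:
  assumes "\<not> int p dvd a"
  obtains s where "[a = int g ^ s] (mod int p)"
proof -
  have pos: "0 < a mod int p" "a mod int p < int p"
    using assms p_gt pos_mod_bound[of "int p" a] pos_mod_sign[of "int p" a]
    by (auto simp: dvd_eq_mod_eq_0 order_less_le simp del: pos_mod_bound pos_mod_sign)
  then have "nat (a mod int p) \<in> (\<lambda>i. g ^ i mod p) ` {..<p - 1}"
    unfolding bij_betw_imp_surj_on[OF g_power_bij] by auto
  then obtain s where s: "nat (a mod int p) = g ^ s mod p"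
    by (rule imageE)
  have "a mod int p = int (nat (a mod int p))" using pos by simp
  also have "\<dots> = int g ^ s mod int p" unfolding s by (simp add: zmod_int)
  finally show ?thesis using that by (simp add: cong_def)
qed

lemma g_power_period: "[int g ^ (i + (p - 1)) = int g ^ i] (mod int p)"
proof -
  have "\<not> p dvd g"
    using coprime_g(1) p_gt by (metis coprime_absorb_left nat_dvd_1_iff_1 not_numeral_less_one)
  then have "[g ^ (p - 1) = 1] (mod p)"
    using fermat_theorem[OF prime_p] by simp
  then have "[int g ^ (p - 1) = 1] (mod int p)"
    by (metis cong_int_iff of_nat_1 of_nat_power)
  from cong_mult[OF cong_refl this, of "int g ^ i"] show ?thesis
    by (simp add: power_add)
qed

text \<open>For \<open>t = 0\<close> the powers of \<open>g\<close> run through the nonzero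
  residues. Raising \<open>t\<close> by one replaces the first factor by one that equals it, because
  \<open>g ^ (p - 1)\<close> is 1 modulo p.\<close>

lemma orbit_prod:
  fixes h :: "int \<Rightarrow> real"
  assumes per: "\<And>a b. [a = b] (mod int p) \<Longrightarrow> h a = h b"
  shows "(\<Prod>i<p - 1. h (int g ^ (i + t))) = (\<Prod>c\<in>{1..<p}. h (int c))"
proof (induction t)
  case 0
  have "(\<Prod>i<p - 1. h (int g ^ i)) = (\<Prod>i<p - 1. h (int (g ^ i mod p)))"
    by (intro prod.cong refl per) (simp add: cong_def zmod_int)
  also have "\<dots> = (\<Prod>c\<in>{1..<p}. h (int c))"
    using prod.reindex_bij_betw[OF g_power_bij, of "\<lambda>c. h (int c)"] by simp
  finally show ?case by simp
next
  case (Suc t)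
  let ?h = "\<lambda>i. h (int g ^ (i + t))"
  have "?h (p - 1) = ?h 0"
    using per[OF g_power_period[of t]] by (simp add: add.commute)
  have p1: "p - 1 = Suc (p - 2)" using p_gt by simp
  have "(\<Prod>i<p - 1. ?h (Suc i)) = (\<Prod>i<p - 2. ?h (Suc i)) * ?h (p - 1)"
    unfolding p1 by simp
  also have "\<dots> = ?h 0 * (\<Prod>i<p - 2. ?h (Suc i))"
    unfolding \<open>?h (p - 1) = ?h 0\<close> by simp
  also have "\<dots> = (\<Prod>i<p - 1. ?h i)"
    unfolding p1 by (simp add: prod.lessThan_Suc_shift del: prod.lessThan_Suc)
  finally show ?case using Suc by simp
qed

lemma S_cong: "[j = k] (mod int p) \<Longrightarrow> S j = S k"
  unfolding S_def fun_eq_iff using p_gt by (intro allI trig_cong(2)) (auto intro: cong_scalar_right)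

lemma S_eq_0: "int p dvd j \<Longrightarrow> S j = (\<lambda>x. 0)"
  using S_cong[of j 0] by (simp add: cong_0_iff S_def[abs_def])

lemma S_uminus: "S (- j) x = - S j x"
  by (simp add: S_def)

lemma S_nonzero: "\<not> int p dvd j \<Longrightarrow> S j x \<noteq> 0"
proof
  assume j: "\<not> int p dvd j" and "S j x = 0"
  then obtain i :: int where "2 * pi * of_int (j * int g ^ fst x) / real p = of_int i * pi"
    unfolding S_def by (auto simp: sin_zero_iff_int2)
  then have "(of_int (2 * (j * int g ^ fst x)) :: real) = of_int (i * int p)"
    using p_gt by (simp add: field_simps)
  then have "2 * (j * int g ^ fst x) = i * int p" by (simp only: of_int_eq_iff)
  then have "int p dvd 2 * (j * int g ^ fst x)" by simp
  moreover have "coprime (int p) 2" using odd_p by simp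
  moreover have "coprime (int p) (int g ^ fst x)" using coprime_g by simp
  ultimately show False using j by (simp add: coprime_dvd_mult_left_iff coprime_dvd_mult_right_iff)
qed

lemma C_times_S: "C a x * S j x = S (j + a) x + S (j - a) x"
  by (simp add: C_def S_def algebra_simps add_divide_distrib diff_divide_distrib sin_add sin_diff)

text \<open>The left side is the numerator of a difference of two sine quotients; that it is again a
  product of sines is why such a difference is a unit.\<close>

lemma S_identity: "S (k + 1) x * S l x - S (l + 1) x * S k x = S 1 x * S (l - k) x"
  by (simp add: S_def algebra_simps add_divide_distrib diff_divide_distrib sin_add sin_diff)

lemma S_next: "S j (next_point x) = S (j * int g) x"
  by (cases x) (simp add: S_def next_point_def mult_ac)

lemma S_period: "S j ((next_point ^^ (p - 1)) x) = S j x"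
proof -
  have "[j * int g ^ (p - 1 + fst x) = j * int g ^ fst x] (mod int p)"
    using g_power_period[of "fst x"] by (simp add: add.commute cong_scalar_left)
  from trig_cong(2)[OF this] show ?thesis
    using p_gt by (simp add: S_def next_point_power)
qed

definition norm_S :: real where
  "norm_S = (\<Prod>c\<in>{1..<p}. sin (2 * pi * of_int (int c) / real p))"

text \<open>Modulo p, \<open>j\<close> is a power of \<open>g\<close>, so it only moves the starting
  point of the orbit. The common value matters only through being nonzero, since it cancels from
  quotients.\<close>

lemma prod_S:
  assumes "\<not> int p dvd j"
  shows "(\<Prod>i<p - 1. S j ((next_point ^^ i) x)) = norm_S"
proof -
  define h where "h a = sin (2 * pi * of_int a / real p)" for a :: int
  have h: "h a = h b" if "[a = b] (mod int p)" for a b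
    using trig_cong(2)[OF that] p_gt by (simp add: h_def)
  obtain s where s: "[j = int g ^ s] (mod int p)" using power_of_g[OF assms] .
  have "S j ((next_point ^^ i) x) = h (int g ^ (i + (s + fst x)))" for i
  proof -
    have "[j * int g ^ (i + fst x) = int g ^ s * int g ^ (i + fst x)] (mod int p)"
      using s by (rule cong_scalar_right)
    then have "h (j * int g ^ (i + fst x)) = h (int g ^ (i + (s + fst x)))"
      by (intro h) (simp add: power_add mult_ac)
    then show ?thesis by (simp add: S_def next_point_power h_def)
  qed
  then show ?thesis using orbit_prod[of h, OF h] by (simp add: norm_S_def h_def)
qed

lemma norm_S_nonzero: "norm_S \<noteq> 0"
proof -
  have "\<not> int p dvd 1" using p_gt by auto
  then show ?thesis using prod_S[of 1 "(0, True)"] S_nonzero[of 1] by (metis prod_zero_iff finite_lessThan)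
qed

lemma prod_psi_minus_C:
  assumes "p mod 5 = 2 \<or> p mod 5 = 3"
  shows "(\<Prod>i<p - 1. psi (snd x) - C 1 ((next_point ^^ i) x)) = 2 + psi (snd x)"
proof -
  define e where "e = snd x"
  define a where "a = (if e then 2 * pi / 5 else 4 * pi / 5)"
  have psi_a: "psi e = 2 * cos a" using cos_2pi_5 cos_4pi_5 by (auto simp: a_def psi_def)
  define h where "h c = psi e - 2 * cos (2 * pi * of_int c / real p)" for c :: int
  have h: "h c = h d" if "[c = d] (mod int p)" for c d
    using trig_cong(1)[OF that] p_gt by (simp add: h_def)
  have "(\<Prod>i<p - 1. psi e - C 1 ((next_point ^^ i) x)) = (\<Prod>i<p - 1. h (int g ^ (i + fst x)))"
    by (simp add: C_def h_def next_point_power)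
  also have "\<dots> = (\<Prod>c\<in>{1..<p}. h (int c))"
    by (rule orbit_prod[OF h])
  finally have prod_h: "(\<Prod>i<p - 1. psi e - C 1 ((next_point ^^ i) x)) = (\<Prod>c\<in>{1..<p}. h (int c))" .
  \<comment> \<open>The residue 0 contributes the extra factor psi - 2, which is nonzero and is
    cancelled at the end.\<close>
  have "{..<p} = insert 0 {1..<p}" using p_gt by auto
  then have "(psi e - 2) * (\<Prod>c\<in>{1..<p}. h (int c)) = (\<Prod>c<p. h (int c))"
    by (simp add: h_def)
  also have "\<dots> = 2 * cos (real p * a) - 2"
    using prod_diff_cos[of p a] p_gt by (simp add: h_def psi_a)
  \<comment> \<open>Multiplication by p = +-2 mod 5 exchanges the angles 2 pi/5 and 4 pi/5 up to
    sign and full turns, so it conjugates \<open>psi\<close>.\<close>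
  also have "2 * cos (real p * a) = psi (\<not> e)"
  proof -
    have cos5: "cos (real p * (2 * pi * of_int k / 5)) = cos (2 * pi * of_int l / 5)"
      if "[int p * k = l] (mod 5)" for k l
      using trig_cong(1)[of "int p * k" l 5] that by (simp add: mult_ac)
    have "int p mod 5 = 2 \<or> int p mod 5 = 3"
      using assms by presburger
    then have "cos (real p * (2 * pi / 5)) = cos (4 * pi / 5) \<and> cos (real p * (4 * pi / 5)) = cos (2 * pi / 5)"
    proof
      assume "int p mod 5 = 2"
      then have "[int p * 1 = 2] (mod 5)" "[int p * 2 = -1] (mod 5)"
        unfolding cong_def by presburger+
      from this[THEN cos5] show ?thesis by simp
    next
      assume "int p mod 5 = 3"
      then have "[int p * 1 = -2] (mod 5)" "[int p * 2 = 1] (mod 5)"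
        unfolding cong_def by presburger+
      from this[THEN cos5] show ?thesis by simp
    qed
    then show ?thesis
      using cos_2pi_5 cos_4pi_5 by (cases e) (simp_all add: a_def psi_def)
  qed
  also have "psi (\<not> e) - 2 = (psi e - 2) * (2 + psi e)"
    by (simp add: psi_Not psi_square algebra_simps)
  finally have "(psi e - 2) * (\<Prod>c\<in>{1..<p}. h (int c)) = (psi e - 2) * (2 + psi e)" .
  moreover have "psi e \<noteq> 2" using psi_square[of e] by auto
  ultimately show ?thesis using prod_h by (simp add: e_def)
qed

end

section \<open>The sine lattice: its rank, its multipliers and its clique\<close>

context sine_lattice begin

text \<open>As \<open>S\<close> is odd and p-periodic in its index, the indices 1 to
  \<open>m\<close> represent all sines up to sign; taking them with coefficients 1 and
  \<open>psi\<close> gives \<open>2 * m\<close> = p - 1 functions.\<close>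

definition sine_basis :: "nat \<Rightarrow> nat \<times> bool \<Rightarrow> real" where
  "sine_basis i x = (if i < m then S (int i + 1) x else psi (snd x) * S (int (i - m) + 1) x)"

text \<open>The product formula leaves cosine sums of frequencies i - j and i + j + 2. Both are
  below p in absolute value since i, j < m, so only frequency 0 survives.\<close>

lemma sines_orthogonal:
  assumes "i < m" "j < m"
  shows "(\<Sum>c<p. sin (2 * pi * of_int ((int i + 1) * int c) / real p) *
      sin (2 * pi * of_int ((int j + 1) * int c) / real p))
    = (if i = j then real p / 2 else 0)"
proof -
  define f where "f l = (\<Sum>c<p. cos (2 * pi * of_int l * real c / real p))" for l :: int
  have f: "f l = (if l = 0 then real p else 0)" if "\<bar>l\<bar> < int p" for l
  proof (cases "l = 0")
    case False
    then have "\<not> int p dvd l" using that zdvd_imp_le by (metis abs_of_nat dvd_imp_le_int not_le)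
    then show ?thesis using sum_cos_multiples[of p l] p_gt False by (simp add: f_def)
  qed (simp add: f_def)
  have "(\<Sum>c<p. sin (2 * pi * of_int ((int i + 1) * int c) / real p) *
        sin (2 * pi * of_int ((int j + 1) * int c) / real p))
      = (\<Sum>c<p. (cos (2 * pi * of_int (int i - int j) * real c / real p) -
        cos (2 * pi * of_int (int i + int j + 2) * real c / real p)) / 2)"
    by (intro sum.cong refl) (simp add: sin_times_sin algebra_simps diff_divide_distrib add_divide_distrib)
  also have "\<dots> = (f (int i - int j) - f (int i + int j + 2)) / 2"
    by (simp add: f_def flip: sum_subtractf sum_divide_distrib)
  also have "\<dots> = (if i = j then real p / 2 else 0)"
    using assms m(1) by (simp add: f)
  finally show ?thesis .
qed

text \<open>Pairing with the j-th sine isolates \<open>w j\<close>; the residue 0, which no power of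
  \<open>g\<close> reaches, contributes nothing. The weights are real so that, for fixed
  \<open>e\<close>, coefficients a + b psi can be inserted.\<close>

lemma sines_independent:
  assumes "\<And>t. (\<Sum>i<m. w i * S (int i + 1) (t, e)) = 0" "j < m"
  shows "w j = 0"
proof -
  let ?s = "\<lambda>i c. sin (2 * pi * of_int ((int i + 1) * int c) / real p)"
  have all: "(\<Sum>i<m. w i * ?s i c) = 0" for c
  proof (cases "int p dvd int c")
    case True
    then have "?s i c = 0" for i
      using trig_cong(2)[of "(int i + 1) * int c" 0 p] p_gt by (simp add: cong_0_iff)
    then show ?thesis by simp
  next
    case False
    then obtain t where t: "[int c = int g ^ t] (mod int p)" by (rule power_of_g)
    have "?s i c = S (int i + 1) (t, e)" for i
      using trig_cong(2)[OF cong_scalar_left[OF t, of "int i + 1"]] p_gt by (simp add: S_def)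
    then show ?thesis using assms(1)[of t] by simp
  qed
  have "0 = (\<Sum>c<p. (\<Sum>i<m. w i * ?s i c) * ?s j c)"
    unfolding all by simp
  also have "\<dots> = (\<Sum>i<m. w i * (\<Sum>c<p. ?s i c * ?s j c))"
    unfolding sum_distrib_left sum_distrib_right by (subst sum.swap) (simp only: mult.assoc)
  also have "\<dots> = (\<Sum>i<m. w i * (if i = j then real p / 2 else 0))"
    by (intro sum.cong refl arg_cong2[of _ _ _ _ "(*)"] sines_orthogonal) (use assms(2) in auto)
  also have "\<dots> = w j * (real p / 2)"
    using assms(2) by (simp add: if_distrib cong: if_cong)
  finally show ?thesis using p_gt by simp
qed

sublocale function_lattice "2 * m" sine_basis
proof
  fix z :: "nat \<Rightarrow> int" and i
  assume *: "\<And>x. (\<Sum>i<2 * m. of_int (z i) * sine_basis i x) = 0" and i: "i < 2 * m"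
  have split: "(\<Sum>i<2 * m. f i) = (\<Sum>i<m. f i) + (\<Sum>i<m. f (m + i))" for f :: "nat \<Rightarrow> real"
    using sum.atLeastLessThan_concat[of 0 m "2 * m" f] sum.shift_bounds_nat_ivl[of f 0 m m]
    by (simp add: atLeast0LessThan add.commute mult_2)
  have "(\<Sum>i<m. (of_int (z i) + of_int (z (m + i)) * psi e) * S (int i + 1) (t, e)) = 0" for e t
    using *[of "(t, e)"] by (simp add: split sine_basis_def[of _ "(t, e)"] sum.distrib distrib_right mult.assoc)
  then have zero: "of_int (z j) + of_int (z (m + j)) * psi e = 0" if "j < m" for j e
    using sines_independent[OF _ that, of "\<lambda>i. of_int (z i) + of_int (z (m + i)) * psi e" e] by blast
  have zz: "z j = 0" "z (m + j) = 0" if "j < m" for j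
    using psi_independent[OF zero[OF that]] by auto
  show "z i = 0"
  proof (cases "i < m")
    case False
    then have "i = m + (i - m)" "i - m < m" using i m(1) by auto
    then show ?thesis using zz(2) by metis
  qed (rule zz)
qed

lemma S_in_L: "S j \<in> L" and psi_S_in_L: "(\<lambda>x. psi (snd x) * S j x) \<in> L"
proof -
  define r where "r = j mod int p"
  have Sj: "S j = S r" by (rule S_cong) (simp add: r_def cong_def)
  have r: "0 \<le> r" "r < int p" using p_gt by (auto simp: r_def)
  have basis: "S (int k + 1) \<in> L" "(\<lambda>x. psi (snd x) * S (int k + 1) x) \<in> L" if "k < m" for k
    using basis_in_L[of k] basis_in_L[of "m + k"] that m(1) by (simp_all add: sine_basis_def[abs_def])
  \<comment> \<open>Every residue is 0, one of 1 to \<open>m\<close>, or the negative of one of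
    these, where the sine changes sign.\<close>
  consider "r = 0" | k where "k < m" "r = int k + 1" | k where "k < m" "r = int p - (int k + 1)"
  proof -
    assume *: "r = 0 \<Longrightarrow> thesis" "\<And>k. k < m \<Longrightarrow> r = int k + 1 \<Longrightarrow> thesis"
      "\<And>k. k < m \<Longrightarrow> r = int p - (int k + 1) \<Longrightarrow> thesis"
    show thesis
    proof (cases "r \<le> int m")
      case True
      then show ?thesis using *(1) *(2)[of "nat (r - 1)"] r by (cases "r = 0") auto
    next
      case False
      then show ?thesis using *(3)[of "nat (int p - r - 1)"] r m(1) by auto
    qed
  qed
  then have "S j \<in> L \<and> (\<lambda>x. psi (snd x) * S j x) \<in> L"
  proof cases
    case 1
    then show ?thesis unfolding Sj by (simp add: S_eq_0 L_zero)
  next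
    case 2
    then show ?thesis unfolding Sj using basis by simp
  next
    case (3 k)
    have "S r = S (- (int k + 1))" by (rule S_cong) (simp add: 3 cong_iff_dvd_diff)
    also have "\<dots> = (\<lambda>x. - S (int k + 1) x)" by (rule ext) (rule S_uminus)
    finally have "S r = (\<lambda>x. - S (int k + 1) x)" .
    then show ?thesis unfolding Sj using L_minus[OF basis(1)[OF 3(1)]] L_minus[OF basis(2)[OF 3(1)]] by simp
  qed
  then show "S j \<in> L" "(\<lambda>x. psi (snd x) * S j x) \<in> L" by auto
qed

lemma multiplier_psi: "multiplier (\<lambda>x. psi (snd x))"
proof (rule multiplierI)
  fix i
  show "(\<lambda>x. psi (snd x) * sine_basis i x) \<in> L"
    using L_diff[OF S_in_L psi_S_in_L] psi_S_in_L
    by (cases "i < m") (simp_all add: sine_basis_def psi_cancel)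
qed

lemma multiplier_if_S:
  assumes "\<And>j. (\<lambda>x. u x * S j x) \<in> L"
  shows "multiplier u"
proof (rule multiplierI)
  fix i
  show "(\<lambda>x. u x * sine_basis i x) \<in> L"
    using assms multiplierD[OF multiplier_psi assms]
    by (cases "i < m") (simp_all add: sine_basis_def mult.left_commute)
qed

lemma multiplier_C: "multiplier (C a)"
  by (rule multiplier_if_S) (simp add: C_times_S L_add S_in_L)

text \<open>Modulo p, a = k b for some natural k, and S_(kb) / S_b is a Chebyshev polynomial in
  \<open>C b\<close>. The induction follows the three-term recurrence, hence carries two consecutive
  indices.\<close>

lemma multiplier_S_ratio:
  assumes b: "\<not> int p dvd b"
  shows "multiplier (\<lambda>x. S a x / S b x)"
proof -
  have mult: "multiplier (\<lambda>x. S (int k * b) x / S b x) \<and> multiplier (\<lambda>x. S (int (Suc k) * b) x / S b x)" for k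
  proof (induction k)
    case 0
    then show ?case
      using multiplier_const[of 0] multiplier_const[of 1] S_nonzero[OF b] by (simp add: S_eq_0)
  next
    case (Suc k)
    have "S (int (Suc (Suc k)) * b) x / S b x =
        C b x * (S (int (Suc k) * b) x / S b x) - S (int k * b) x / S b x" for x
      using C_times_S[of b x "int (Suc k) * b"] by (simp add: algebra_simps diff_divide_distrib[symmetric])
    then show ?case
      using Suc multiplier_diff[OF multiplier_mult[OF multiplier_C[of b]],
          of "\<lambda>x. S (int (Suc k) * b) x / S b x" "\<lambda>x. S (int k * b) x / S b x"]
      by simp
  qed
  have "coprime b (int p)"
    using b prime_p by (metis coprime_commute prime_imp_coprime prime_int_nat_transfer prime_nat_int_transfer)
  then obtain c where c: "[b * c = 1] (mod int p)"
    using cong_solve_coprime_int by blast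
  define k where "k = nat ((a * c) mod int p)"
  have "int k = (a * c) mod int p" using p_gt by (simp add: k_def)
  then have "[int k * b = a * c * b] (mod int p)"
    by (intro cong_scalar_right) (simp add: cong_def)
  also have "[a * c * b = a * 1] (mod int p)"
    using cong_scalar_left[OF c, of a] by (simp add: mult_ac)
  finally have "S (int k * b) = S a" using S_cong by simp
  then show ?thesis using mult[of k] by simp
qed

text \<open>The index is shifted by one so that the p - 1 nonzero denominators are counted from 0;
  the quotient for k = p - 2 is the zero function.\<close>

definition sine_quotient :: "nat \<Rightarrow> nat \<times> bool \<Rightarrow> real" where
  "sine_quotient k x = S (int k + 2) x / S (int k + 1) x"

lemma index_nonzero: "k < p - 1 \<Longrightarrow> \<not> int p dvd int k + 1"
  using zdvd_imp_le[of "int p" "int k + 1"] by auto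

lemma index_diff_nonzero: "k < p - 1 \<Longrightarrow> l < p - 1 \<Longrightarrow> k \<noteq> l \<Longrightarrow> \<not> int p dvd int l - int k"
proof
  assume *: "k < p - 1" "l < p - 1" "k \<noteq> l" "int p dvd int l - int k"
  then have "\<bar>int p\<bar> \<le> \<bar>int l - int k\<bar>" by (intro dvd_imp_le_int) auto
  then show False using * by auto
qed

lemma sine_quotient_diff:
  assumes "k < p - 1" "l < p - 1" "k \<noteq> l"
  shows "sine_quotient k x - sine_quotient l x =
    (S 1 x * S (int l - int k) x) / (S (int k + 1) x * S (int l + 1) x)"
  using S_identity[of "int k + 1" x "int l + 1"] S_nonzero[OF index_nonzero] assms
  by (simp add: sine_quotient_def field_simps)

theorem clique_number_ge:
  assumes p5: "p mod 5 = 2 \<or> p mod 5 = 3"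
  shows "enat ((p - 1)\<^sup>2) \<le> clique_number (Mat_int (2 * m))"
proof (rule clique_of_twisted_multipliers[where s = next_point and N = "p - 1"
      and \<theta> = "\<lambda>x. psi (snd x) - C 1 x" and \<kappa> = "\<lambda>x. 2 + psi (snd x)" and c = sine_quotient])
  have one: "\<not> int p dvd 1" using p_gt by auto
  show "2 * m > 0" "p - 1 > 0" "even (p - 1)" using p_gt odd_p m(2) by auto
  show "sine_basis i ((next_point ^^ (p - 1)) x) = sine_basis i x" for i x
    unfolding sine_basis_def S_period by (simp add: next_point_power)
  have theta: "multiplier (\<lambda>x. psi (snd x) - C 1 x)"
    by (intro multiplier_diff multiplier_psi multiplier_C)
  have "(\<lambda>x. sine_basis i (next_point x)) \<in> L" for i
  proof -
    have "snd (next_point x) = snd x" for x by (cases x) (simp add: next_point_def)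
    then show ?thesis
      using S_in_L psi_S_in_L by (cases "i < m") (simp_all add: sine_basis_def S_next)
  qed
  then show "(\<lambda>x. (psi (snd x) - C 1 x) * sine_basis i (next_point x)) \<in> L" for i
    by (rule multiplierD[OF theta])
  show "(\<Prod>i<p - 1. psi (snd ((next_point ^^ i) x)) - C 1 ((next_point ^^ i) x)) = 2 + psi (snd x)" for x
    using prod_psi_minus_C[OF p5, of x] by (simp add: next_point_power)
  show "2 + psi (snd x) \<noteq> 0" "2 + psi (snd x) \<noteq> 1" for x :: "nat \<times> bool"
    using psi_unit[of "snd x"] by auto
  show "multiplier (\<lambda>x. 1 / (2 + psi (snd x)))"
    unfolding kappa_inverse by (intro multiplier_mult multiplier_psi)
  show "multiplier (\<lambda>x. 1 / (1 - (2 + psi (snd x))))"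
    unfolding one_minus_kappa_inverse
    using multiplier_mult[OF multiplier_const[of "-1"] multiplier_psi] by simp
  show "multiplier (sine_quotient k)" if "k < p - 1" for k
    unfolding sine_quotient_def[abs_def] by (rule multiplier_S_ratio[OF index_nonzero[OF that]])
  fix k l assume kl: "k < p - 1" "l < p - 1" "k \<noteq> l"
  note nz = one index_diff_nonzero[OF kl] index_nonzero[OF kl(1)] index_nonzero[OF kl(2)]
  show "sine_quotient k x - sine_quotient l x \<noteq> 0" for x
    unfolding sine_quotient_diff[OF kl] using nz[THEN S_nonzero] by simp
  \<comment> \<open>The inverse regroups into two ratios of sines whose denominators have index
    prime to p, so both are multipliers.\<close>
  have "1 / (sine_quotient k x - sine_quotient l x) =
      (S (int k + 1) x / S 1 x) * (S (int l + 1) x / S (int l - int k) x)" for x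
    unfolding sine_quotient_diff[OF kl] by simp
  then show "multiplier (\<lambda>x. 1 / (sine_quotient k x - sine_quotient l x))"
    using multiplier_mult[OF multiplier_S_ratio[OF nz(1)] multiplier_S_ratio[OF nz(2)]] by simp
  \<comment> \<open>Two sines stand above and two below, and all four have the norm
    \<open>norm_S\<close>.\<close>
  show "(\<Prod>i<p - 1. sine_quotient k ((next_point ^^ i) x) - sine_quotient l ((next_point ^^ i) x)) = 1" for x
    unfolding sine_quotient_diff[OF kl] prod_dividef prod.distrib nz[THEN prod_S] using norm_S_nonzero by simp
qed

end

section \<open>The case p = 2 and the assembly of the cases\<close>

lemma clique_number_Mat_1: "enat 1 \<le> clique_number (Mat_int 1)"
  using clique_number_ge_card[of "Mat_int 1" "{1\<^sub>m 1}"]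
  by (simp add: exceptional_clique_def ring_mat_simps)

theorem corollary6p6:
  fixes p :: nat
  assumes "prime p"
    and "\<not> [int p = 1] (mod 5)"
    and "\<not> [int p = -1] (mod 5)"
  shows "clique_number (Mat_int (p - 1)) \<ge> enat ((p - 1)\<^sup>2)"
proof -
  have "int p mod 5 \<noteq> 1" "int p mod 5 \<noteq> 4"
    using assms(2,3) by (simp_all add: cong_def)
  then have "p mod 5 \<noteq> 1" "p mod 5 \<noteq> 4"
    by presburger+
  then consider "p mod 5 = 0" | "p mod 5 = 2 \<or> p mod 5 = 3" by linarith
  then show ?thesis
  proof cases
    case 1
    then have "p = 5" using assms(1) primes_dvd_imp_eq[of 5 p] by auto
    then show ?thesis using clique_number_Mat_4 by simp
  next
    case 2
    show ?thesis
    proof (cases "p = 2")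
      case True
      then show ?thesis using clique_number_Mat_1 by (simp add: one_enat_def)
    next
      case False
      then have "odd p" using assms(1) primes_dvd_imp_eq[of 2 p] by auto
      obtain g where "residue_primroot p g"
        using prime_primitive_root_exists[of p] assms(1) prime_gt_1_nat by auto
      with assms(1) \<open>odd p\<close> interpret sine_lattice p g by unfold_locales
      have "2 * m = p - 1" using m(1) by simp
      then show ?thesis using clique_number_ge[OF 2] by (simp only:)
    qed
  qed
qed

end
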